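(* For all $m,k\in\mathbb{N}$ with $3\le k\le\frac m2$, there exist a finite set $V$, a submodular order function $|\cdot|$ on the set $U_{bip}(V)$ of all bipartitions of $V$, and an $m$-tangle $\tau_{m,k}$ in $U_{bip}(V)$ (with respect to this order function) that has $m$ maximal elements and is $k$-resilient, but which is not induced by any function $w\colon V\to\mathbb{R}_{\ge0}$ on $V$.
   Context: A separation of a finite set $V$ is an unordered pair $\{A,B\}$ of subsets of $V$ with $A\cup B=V$; it is a bipartition if $A\cap B=\emptyset$ (sides may be empty). $U_{bip}(V)$ denotes the set of all bipartitions of $V$. The two orientations of $\{A,B\}$ are the ordered pairs $(A,B)$ and $(B,A)$. Oriented separations are partially ordered by $(A,B)\le (C,D)$ if and only if $A\subseteq C$ and $B\supseteq D$. The supremum of $(A,B)$ and $(C,D)$ is $(A\cup C,B\cap D)$ and their infimum is $(A\cap C,B\cup D)$. Maximal elements of a set of oriented separations are those maximal with respect to $\le$. An order function on $U=U_{bip}(V)$ assigns to each $s\in U$ an integer $|s|\ge0$, its order; both orientations of $s$ are given the same order $|s|$. It is submodular if $|\vec r\vee\vec s|+|\vec r\wedge\vec s|\le|\vec r|+|\vec s|$ for all orientations $\vec r,\vec s$ of separations in $U$. For $m\in\mathbb{N}$, $S_m$ denotes the set of all separations in $U$ of order less than $m$. An orientation of a set $S$ of separations of $V$ is a set $\tau$ consisting of exactly one orientation of each $s\in S$ (and nothing else). It is consistent if there are no two $(A,B),(C,D)\in\tau$ with $(B,A)<(C,D)$. A tangle of $S$ is a consistent orientation $\tau$ of $S$ such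 that there are no (not necessarily distinct) $(A_1,B_1),(A_2,B_2),(A_3,B_3)\in\tau$ with $A_1\cup A_2\cup A_3=V$. An $m$-tangle in $U$ is a tangle of $S_m$. An orientation $\tau$ is $k$-resilient if $\bigcup_{(A,B)\in\sigma}A\neq V$ for every set $\sigma\subseteq\tau$ of size at most $k$. For $w\colon V\to\mathbb{R}_{\ge0}$ and $Z\subseteq V$ write $w(Z)=\sum_{v\in Z}w(v)$. The function $w$ induces $\tau$ if $w(A)<w(B)$ for all $(A,B)\in\tau$. *)

theory Defs
  imports Complex_Main
begin

type_synonym 'a sep = "'a set set"
type_synonym 'a osep = "'a set \<times> 'a set"

text \<open>A separation is the unordered pair \<open>{A, B}\<close>, represented as a set of sets;
  an oriented separation is an ordered pair.\<close>

definition separations :: "'a set \<Rightarrow> 'a sep set" where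
  "separations V = {{A, B} | A B. A \<union> B = V}"

definition U_bip :: "'a set \<Rightarrow> 'a sep set" where
  "U_bip V = {s \<in> separations V. \<exists>A B. s = {A, B} \<and> A \<inter> B = {}}"

definition orientations :: "'a sep \<Rightarrow> 'a osep set" where
  "orientations s = {(A, B). {A, B} = s}"

definition osep_le :: "'a osep \<Rightarrow> 'a osep \<Rightarrow> bool" where
  "osep_le r s \<longleftrightarrow> fst r \<subseteq> fst s \<and> snd r \<supseteq> snd s"

definition osep_less :: "'a osep \<Rightarrow> 'a osep \<Rightarrow> bool" where
  "osep_less r s \<longleftrightarrow> osep_le r s \<and> r \<noteq> s"

definition osep_sup :: "'a osep \<Rightarrow> 'a osep \<Rightarrow> 'a osep" where
  "osep_sup r s = (fst r \<union> fst s, snd r \<inter> snd s)"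

definition osep_inf :: "'a osep \<Rightarrow> 'a osep \<Rightarrow> 'a osep" where
  "osep_inf r s = (fst r \<inter> fst s, snd r \<union> snd s)"

definition maximal_elements :: "'a osep set \<Rightarrow> 'a osep set" where
  "maximal_elements T = {r \<in> T. \<not> (\<exists>s \<in> T. osep_less r s)}"

text \<open>An order function is a function \<open>f :: 'a sep \<Rightarrow> nat\<close> on unoriented separations, of
  which only the values on the universe \<open>U\<close> matter; an oriented separation inherits the order
  of the separation that it orients.\<close>

definition oorder :: "('a sep \<Rightarrow> nat) \<Rightarrow> 'a osep \<Rightarrow> nat" where
  "oorder f r = f {fst r, snd r}"

definition submodular :: "'a sep set \<Rightarrow> ('a sep \<Rightarrow> nat) \<Rightarrow> bool" where
  "submodular U f \<longleftrightarrow>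
     (\<forall>r \<in> \<Union> (orientations ` U). \<forall>s \<in> \<Union> (orientations ` U).
        oorder f (osep_sup r s) + oorder f (osep_inf r s) \<le> oorder f r + oorder f s)"

definition seps_below :: "'a sep set \<Rightarrow> ('a sep \<Rightarrow> nat) \<Rightarrow> nat \<Rightarrow> 'a sep set" where
  "seps_below U f m = {s \<in> U. f s < m}"

definition orientation_of :: "'a sep set \<Rightarrow> 'a osep set \<Rightarrow> bool" where
  "orientation_of S T \<longleftrightarrow>
     T \<subseteq> \<Union> (orientations ` S) \<and> (\<forall>s \<in> S. \<exists>!r. r \<in> orientations s \<and> r \<in> T)"

text \<open>The two elements in the definition of consistency are distinct. In a tangle of
  bipartitions this makes no difference: \<open>(B, A) < (A, B)\<close> forces \<open>A = V\<close>, which the covering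
  condition excludes.\<close>

definition consistent :: "'a osep set \<Rightarrow> bool" where
  "consistent T \<longleftrightarrow>
     \<not> (\<exists>A B C D. (A, B) \<in> T \<and> (C, D) \<in> T \<and> (A, B) \<noteq> (C, D) \<and> osep_less (B, A) (C, D))"

definition tangle :: "'a set \<Rightarrow> 'a sep set \<Rightarrow> 'a osep set \<Rightarrow> bool" where
  "tangle V S T \<longleftrightarrow>
     orientation_of S T \<and> consistent T \<and>
     \<not> (\<exists>A1 B1 A2 B2 A3 B3. (A1, B1) \<in> T \<and> (A2, B2) \<in> T \<and> (A3, B3) \<in> T \<and>
          A1 \<union> A2 \<union> A3 = V)"

definition m_tangle :: "'a set \<Rightarrow> 'a sep set \<Rightarrow> ('a sep \<Rightarrow> nat) \<Rightarrow> nat \<Rightarrow> 'a osep set \<Rightarrow> bool" where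
  "m_tangle V U f m T \<longleftrightarrow> tangle V (seps_below U f m) T"

definition resilient :: "'a set \<Rightarrow> nat \<Rightarrow> 'a osep set \<Rightarrow> bool" where
  "resilient V k T \<longleftrightarrow>
     (\<forall>P. P \<subseteq> T \<and> finite P \<and> card P \<le> k \<longrightarrow> (\<Union>(A, B) \<in> P. A) \<noteq> V)"

definition induces :: "('a \<Rightarrow> real) \<Rightarrow> 'a osep set \<Rightarrow> bool" where
  "induces w T \<longleftrightarrow> (\<forall>(A, B) \<in> T. sum w A < sum w B)"

end

theory Submission
  imports Defs "HOL-Library.Nat_Bijection"
begin

text \<open>
  Every finite family \<open>F\<close> of subsets of \<open>V\<close>, no two of which cover \<open>V\<close>, carries an order
  function of its own: give the bipartition \<open>{A, B}\<close> the order \<open>card F\<close> minus the number of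
  members of \<open>F\<close> that contain \<open>A\<close> or \<open>B\<close>. It is submodular because containment in a fixed
  set \<open>C\<close>, as a function of the set contained in \<open>C\<close>, is supermodular, and complementation
  preserves supermodularity. A bipartition has order less than \<open>card F\<close> exactly if one of its
  sides lies inside a member of \<open>F\<close>, so pointing away from that side orients it. The resulting
  orientation is a tangle as soon as no three members of \<open>F\<close> cover \<open>V\<close>; its maximal elements
  are the members of \<open>F\<close> if these form an antichain; and it is resilient to exactly the extent
  to which the members of \<open>F\<close> fail to cover \<open>V\<close>. Thus the value \<open>m\<close> is at once the size of the
  family, the number of maximal elements, and the order bound.

  If each point lies in at least half of the members of \<open>F\<close>, then averaging over \<open>F\<close> shows that
  under any weight function some member receives at least half of the total weight, so no weight
  function induces the tangle.

  It remains to find \<open>m\<close> sets that contain each point at least \<open>m / 2\<close> times although no \<open>k\<close> of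
  them cover. Take as points all subsets \<open>X\<close> of \<open>{..<m}\<close> with at least \<open>m / 2\<close> elements and as
  the \<open>i\<close>-th set those \<open>X\<close> that contain \<open>i\<close>. The sets with index in \<open>K\<close> miss the point
  \<open>{..<m} - K\<close>, which is available as long as \<open>card K \<le> m / 2\<close>.
\<close>

section \<open>The tangle of a non-covering family\<close>

definition supersets_in :: "'a set set \<Rightarrow> 'a set \<Rightarrow> 'a set set" where
  "supersets_in F A = {C \<in> F. A \<subseteq> C}"

definition family_order :: "'a set set \<Rightarrow> 'a sep \<Rightarrow> nat" where
  "family_order F s = card F - (\<Sum>A\<in>s. card (supersets_in F A))"

definition family_tangle :: "'a set \<Rightarrow> 'a set set \<Rightarrow> 'a osep set" where
  "family_tangle V F = {(A, V - A) | A. \<exists>C\<in>F. A \<subseteq> C}"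

lemma in_U_bip_iff:
  "{A, B} \<in> U_bip V \<longleftrightarrow> A \<union> B = V \<and> A \<inter> B = {}"
  unfolding U_bip_def separations_def by (auto simp: doubleton_eq_iff)

lemma in_U_bipE:
  assumes "s \<in> U_bip V"
  obtains A B where "s = {A, B}" "A \<union> B = V" "A \<inter> B = {}"
proof -
  obtain A B where "s = {A, B}"
    using assms unfolding U_bip_def by blast
  then show thesis
    using assms that[of A B] by (simp add: in_U_bip_iff)
qed

lemma orientations_U_bip_iff:
  "(A, B) \<in> \<Union> (orientations ` U_bip V) \<longleftrightarrow> A \<union> B = V \<and> A \<inter> B = {}"
  by (simp add: orientations_def flip: in_U_bip_iff)

text \<open>Summed over the members \<open>C\<close> of \<open>F\<close>, this is the supermodularity of \<open>A \<subseteq> C\<close>: if one of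
  \<open>A\<close> and \<open>A'\<close> lies in \<open>C\<close> then so does their intersection, and if both do then so does their
  union.\<close>

lemma card_supersets_in_supermodular:
  assumes "finite F"
  shows "card (supersets_in F A) + card (supersets_in F A')
    \<le> card (supersets_in F (A \<union> A')) + card (supersets_in F (A \<inter> A'))"
proof -
  let ?S = "supersets_in F"
  have fin: "finite (?S X)" for X
    using assms by (simp add: supersets_in_def)
  have "?S A \<inter> ?S A' = ?S (A \<union> A')" and sub: "?S A \<union> ?S A' \<subseteq> ?S (A \<inter> A')"
    by (auto simp: supersets_in_def)
  then have "card (?S A) + card (?S A') = card (?S A \<union> ?S A') + card (?S (A \<union> A'))"
    using card_Un_Int[OF fin fin] by metis
  then show ?thesis
    using card_mono[OF fin sub] by linarith
qed

text \<open>The bound 3 on \<open>k\<close> is the one in the covering condition for tangles. The empty subfamily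
  covers the empty set, so \<open>V\<close> is nonempty here.\<close>

locale noncovering_family =
  fixes V :: "'a set" and F :: "'a set set" and k :: nat
  assumes finite_V: "finite V"
    and F_subsets: "F \<subseteq> Pow V"
    and three_le_k: "3 \<le> k"
    and not_covering: "\<And>G. G \<subseteq> F \<Longrightarrow> card G \<le> k \<Longrightarrow> \<Union>G \<noteq> V"
begin

lemma finite_F: "finite F"
  using F_subsets finite_V by (metis finite_Pow_iff finite_subset)

lemma V_nonempty: "V \<noteq> {}"
  using not_covering[of "{}"] by auto

lemma in_family_tangleD:
  assumes "(A, B) \<in> family_tangle V F"
  obtains C where "C \<in> F" "A \<subseteq> C" "B = V - A" "A \<subseteq> V"
  using assms F_subsets unfolding family_tangle_def by blast

lemma in_family_tangleI:
  "C \<in> F \<Longrightarrow> A \<subseteq> C \<Longrightarrow> (A, V - A) \<in> family_tangle V F"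
  unfolding family_tangle_def by blast

text \<open>Each separation in the tangle can be replaced by a member of \<open>F\<close> above it, so a cover of \<open>V\<close>
  by sides would give one by at most as many members of \<open>F\<close>.\<close>

lemma resilient_family_tangle: "resilient V k (family_tangle V F)"
  unfolding resilient_def
proof (intro allI impI)
  fix P assume P: "P \<subseteq> family_tangle V F \<and> finite P \<and> card P \<le> k"
  have "\<forall>p\<in>P. \<exists>C. C \<in> F \<and> fst p \<subseteq> C"
  proof
    fix p assume "p \<in> P"
    then obtain A C where "p = (A, V - A)" "C \<in> F" "A \<subseteq> C"
      using P unfolding family_tangle_def by blast
    then show "\<exists>C. C \<in> F \<and> fst p \<subseteq> C" by auto
  qed
  then have "\<exists>c. \<forall>p\<in>P. c p \<in> F \<and> fst p \<subseteq> c p"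
    by (rule bchoice)
  then obtain c where c: "\<And>p. p \<in> P \<Longrightarrow> c p \<in> F \<and> fst p \<subseteq> c p"
    by blast
  have "card (c ` P) \<le> k"
    using P card_image_le[of P c] by linarith
  then have "\<Union> (c ` P) \<noteq> V"
    using c by (intro not_covering) auto
  moreover have "\<Union> (c ` P) \<subseteq> V"
    using c F_subsets by blast
  moreover have "(\<Union>(A, B)\<in>P. A) \<subseteq> \<Union> (c ` P)"
    unfolding case_prod_unfold using c by (intro UN_mono) auto
  ultimately show "(\<Union>(A, B)\<in>P. A) \<noteq> V"
    by blast
qed

lemma three_sides_not_covering:
  assumes "(A1, B1) \<in> family_tangle V F" "(A2, B2) \<in> family_tangle V F"
    "(A3, B3) \<in> family_tangle V F"
  shows "A1 \<union> A2 \<union> A3 \<noteq> V"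
proof -
  let ?P = "{(A1, B1), (A2, B2), (A3, B3)}"
  have "card ?P \<le> k"
    using three_le_k card_insert_le_m1[of 3 "{(A2, B2), (A3, B3)}" "(A1, B1)"]
      card_insert_le_m1[of 2 "{(A3, B3)}" "(A2, B2)"] by simp
  then have "(\<Union>(A, B)\<in>?P. A) \<noteq> V"
    using resilient_family_tangle[unfolded resilient_def, rule_format, of ?P] assms by simp
  then show ?thesis by (simp add: Un_assoc)
qed

text \<open>Members \<open>C \<supseteq> A\<close> and \<open>D \<supseteq> B\<close> would together cover \<open>V\<close>, so no member of \<open>F\<close> is counted
  for both sides of a bipartition, and at most one side counts any member at all.\<close>

lemma supersets_in_one_side:
  assumes "A \<union> B = V"
  shows "supersets_in F A = {} \<or> supersets_in F B = {}"
proof (rule ccontr)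
  assume "\<not> ?thesis"
  then obtain C D where "C \<in> F" "A \<subseteq> C" "D \<in> F" "B \<subseteq> D"
    by (auto simp: supersets_in_def)
  then have "(A, V - A) \<in> family_tangle V F" "(B, V - B) \<in> family_tangle V F"
    by (simp_all add: in_family_tangleI)
  then have "A \<union> B \<union> B \<noteq> V"
    using three_sides_not_covering by blast
  then show False using assms by blast
qed

text \<open>The truncated subtraction in the order function is a true one.\<close>

lemma family_order_bipartition:
  assumes "A \<union> B = V" "A \<inter> B = {}"
  shows "family_order F {A, B} + card (supersets_in F A) + card (supersets_in F B) = card F"
proof -
  have "A \<noteq> B" using assms V_nonempty by blast
  moreover have "card (supersets_in F X) \<le> card F" for X
    using finite_F by (auto simp: supersets_in_def intro: card_mono)
  ultimately show ?thesis
    using supersets_in_one_side[OF assms(1)] unfolding family_order_def by auto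
qed

lemma submodular_family_order: "submodular (U_bip V) (family_order F)"
  unfolding submodular_def
proof (intro ballI)
  fix r s
  assume "r \<in> \<Union> (orientations ` U_bip V)" "s \<in> \<Union> (orientations ` U_bip V)"
  moreover obtain A B C D where rs: "r = (A, B)" "s = (C, D)"
    by (metis surj_pair)
  ultimately have AB: "A \<union> B = V" "A \<inter> B = {}" and CD: "C \<union> D = V" "C \<inter> D = {}"
    by (simp_all only: orientations_U_bip_iff)
  have "(A \<union> C) \<union> (B \<inter> D) = V" "(A \<union> C) \<inter> (B \<inter> D) = {}"
    and "(A \<inter> C) \<union> (B \<union> D) = V" "(A \<inter> C) \<inter> (B \<union> D) = {}"
    using AB CD by blast+
  note orders = family_order_bipartition[OF AB] family_order_bipartition[OF CD]
    family_order_bipartition[OF this(1,2)] family_order_bipartition[OF this(3,4)]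
  show "oorder (family_order F) (osep_sup r s) + oorder (family_order F) (osep_inf r s)
      \<le> oorder (family_order F) r + oorder (family_order F) s"
    using orders card_supersets_in_supermodular[OF finite_F, of A C]
      card_supersets_in_supermodular[OF finite_F, of B D]
    unfolding rs oorder_def osep_sup_def osep_inf_def fst_conv snd_conv by linarith
qed

lemma family_order_less_iff:
  assumes "A \<union> B = V" "A \<inter> B = {}"
  shows "family_order F {A, B} < card F \<longleftrightarrow> (\<exists>C\<in>F. A \<subseteq> C \<or> B \<subseteq> C)"
proof -
  have "family_order F {A, B} < card F
    \<longleftrightarrow> card (supersets_in F A) \<noteq> 0 \<or> card (supersets_in F B) \<noteq> 0"
    using family_order_bipartition[OF assms] by linarith
  also have "\<dots> \<longleftrightarrow> supersets_in F A \<noteq> {} \<or> supersets_in F B \<noteq> {}"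
    using finite_F by (simp add: supersets_in_def)
  finally show ?thesis by (auto simp: supersets_in_def)
qed

lemma orientation_of_family_tangle:
  "orientation_of (seps_below (U_bip V) (family_order F) (card F)) (family_tangle V F)"
  unfolding orientation_of_def
proof (intro conjI ballI)
  show "family_tangle V F
    \<subseteq> \<Union> (orientations ` seps_below (U_bip V) (family_order F) (card F))"
  proof (clarify elim!: in_family_tangleD)
    fix A C assume C: "C \<in> F" "A \<subseteq> C" and "A \<subseteq> V"
    then have part: "A \<union> (V - A) = V" "A \<inter> (V - A) = {}" by blast+
    then have "family_order F {A, V - A} < card F"
      using C by (subst family_order_less_iff) auto
    moreover have "{A, V - A} \<in> U_bip V"
      using part by (simp add: in_U_bip_iff)
    ultimately show "(A, V - A)
      \<in> \<Union> (orientations ` seps_below (U_bip V) (family_order F) (card F))"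
      unfolding seps_below_def orientations_def by blast
  qed
next
  fix s assume "s \<in> seps_below (U_bip V) (family_order F) (card F)"
  then have s: "s \<in> U_bip V" "family_order F s < card F"
    by (simp_all add: seps_below_def)
  from s(1) obtain A B where AB: "s = {A, B}" "A \<union> B = V" "A \<inter> B = {}"
    by (rule in_U_bipE)
  with s(2) have "\<exists>C\<in>F. A \<subseteq> C \<or> B \<subseteq> C"
    by (simp add: family_order_less_iff)
  moreover have "B = V - A" "A = V - B" using AB by blast+
  ultimately have some: "(A, B) \<in> family_tangle V F \<or> (B, A) \<in> family_tangle V F"
    by (metis in_family_tangleI)
  moreover have "\<not> ((A, B) \<in> family_tangle V F \<and> (B, A) \<in> family_tangle V F)"
    using three_sides_not_covering[of A B B A B A] AB(2) by blast
  moreover have "orientations s = {(A, B), (B, A)}"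
    unfolding AB(1) orientations_def by (auto simp: doubleton_eq_iff)
  ultimately show "\<exists>!r. r \<in> orientations s \<and> r \<in> family_tangle V F"
    by auto
qed

lemma m_tangle_family_tangle:
  "m_tangle V (U_bip V) (family_order F) (card F) (family_tangle V F)"
proof -
  have "consistent (family_tangle V F)"
    unfolding consistent_def
  proof (intro notI, elim exE conjE)
    fix A B C D
    assume AB: "(A, B) \<in> family_tangle V F" and CD: "(C, D) \<in> family_tangle V F"
      and "osep_less (B, A) (C, D)"
    then have "B \<subseteq> C" by (simp add: osep_less_def osep_le_def)
    \<comment> \<open>\<open>B\<close> is the complement of \<open>A\<close>, so \<open>A\<close> and \<open>C\<close> would cover \<open>V\<close>.\<close>
    then have "A \<union> C \<union> C = V"
      using AB CD F_subsets by (auto elim!: in_family_tangleD)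
    then show False
      using three_sides_not_covering[OF AB CD CD] by blast
  qed
  then show ?thesis
    unfolding m_tangle_def tangle_def
    using orientation_of_family_tangle three_sides_not_covering by blast
qed

lemma maximal_elements_family_tangle:
  assumes antichain: "\<And>C D. C \<in> F \<Longrightarrow> D \<in> F \<Longrightarrow> C \<subseteq> D \<Longrightarrow> C = D"
  shows "maximal_elements (family_tangle V F) = (\<lambda>C. (C, V - C)) ` F"
proof (intro equalityI subsetI)
  fix r assume r: "r \<in> maximal_elements (family_tangle V F)"
  then obtain A C where A: "r = (A, V - A)" and C: "C \<in> F" "A \<subseteq> C"
    unfolding maximal_elements_def family_tangle_def by blast
  have "\<not> osep_less (A, V - A) (C, V - C)"
    using r in_family_tangleI[OF C(1), of C] unfolding maximal_elements_def A by blast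
  then have "A = C"
    using C unfolding osep_less_def osep_le_def by auto
  then show "r \<in> (\<lambda>C. (C, V - C)) ` F" using A C by blast
next
  fix r assume "r \<in> (\<lambda>C. (C, V - C)) ` F"
  then obtain C where r: "r = (C, V - C)" and C: "C \<in> F" by blast
  have "\<not> osep_less (C, V - C) (A, B)" if AB: "(A, B) \<in> family_tangle V F" for A B
  proof
    assume less: "osep_less (C, V - C) (A, B)"
    obtain D where D: "D \<in> F" "A \<subseteq> D" "B = V - A"
      using AB by (rule in_family_tangleD)
    have "C \<subseteq> A" "C \<noteq> A"
      using less D(3) unfolding osep_less_def osep_le_def by auto
    then show False using antichain[OF C D(1)] D(2) by blast
  qed
  then show "r \<in> maximal_elements (family_tangle V F)"
    using in_family_tangleI[OF C] unfolding maximal_elements_def r by auto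
qed

text \<open>Adding up \<open>w(C) < w(V - C)\<close> over all members \<open>C\<close> shows that they receive on average less
  than half of the total weight. But counting the weight of each point once for every member
  that contains it gives at least half on average.\<close>

lemma family_tangle_not_induced:
  fixes w :: "'a \<Rightarrow> real"
  assumes "F \<noteq> {}"
    and half: "\<And>v. v \<in> V \<Longrightarrow> card F \<le> 2 * card {C \<in> F. v \<in> C}"
    and nonneg: "\<And>v. v \<in> V \<Longrightarrow> 0 \<le> w v"
  shows "\<not> induces w (family_tangle V F)"
proof
  assume ind: "induces w (family_tangle V F)"
  have "2 * sum w C < sum w V" if "C \<in> F" for C
  proof -
    have "sum w C < sum w (V - C)"
      using ind in_family_tangleI[OF that subset_refl] unfolding induces_def by blast
    moreover have "sum w V = sum w (V - C) + sum w C"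
      using that F_subsets finite_V by (intro sum.subset_diff) auto
    ultimately show ?thesis by linarith
  qed
  then have less: "(\<Sum>C\<in>F. 2 * sum w C) < (\<Sum>C\<in>F. sum w V)"
    using finite_F \<open>F \<noteq> {}\<close> by (intro sum_strict_mono) auto
  have "(\<Sum>C\<in>F. sum w C) = (\<Sum>C\<in>F. \<Sum>v\<in>V. if v \<in> C then w v else 0)"
  proof (rule sum.cong[OF refl])
    fix C assume "C \<in> F"
    then have "V \<inter> C = C" using F_subsets by blast
    then show "sum w C = (\<Sum>v\<in>V. if v \<in> C then w v else 0)"
      using sum.inter_restrict[OF finite_V, of w C] by simp
  qed
  also have "\<dots> = (\<Sum>v\<in>V. \<Sum>C\<in>F. if v \<in> C then w v else 0)"
    by (rule sum.swap)
  also have "\<dots> = (\<Sum>v\<in>V. real (card {C \<in> F. v \<in> C}) * w v)"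
    using finite_F by (intro sum.cong refl) (simp flip: sum.inter_filter)
  finally have count: "(\<Sum>C\<in>F. sum w C) = (\<Sum>v\<in>V. real (card {C \<in> F. v \<in> C}) * w v)" .
  have "(\<Sum>C\<in>F. sum w V) = (\<Sum>v\<in>V. real (card F) * w v)"
    by (simp add: sum_distrib_left)
  also have "\<dots> \<le> (\<Sum>v\<in>V. real (2 * card {C \<in> F. v \<in> C}) * w v)"
    using half nonneg by (intro sum_mono mult_right_mono of_nat_mono) auto
  also have "\<dots> = (\<Sum>C\<in>F. 2 * sum w C)"
    by (simp add: count mult.assoc flip: sum_distrib_left)
  finally show False using less by linarith
qed

end

section \<open>Large subsets and the elements they contain\<close>

text \<open>A natural number stands for the set of positions of the ones in its binary expansion.\<close>

definition large_codes :: "nat \<Rightarrow> nat set" where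
  "large_codes m = {v. set_decode v \<subseteq> {..<m} \<and> m \<le> 2 * card (set_decode v)}"

definition codes_containing :: "nat \<Rightarrow> nat \<Rightarrow> nat set" where
  "codes_containing m i = {v \<in> large_codes m. i \<in> set_decode v}"

lemma finite_large_codes: "finite (large_codes m)"
proof (rule finite_subset)
  show "large_codes m \<subseteq> set_encode ` Pow {..<m}"
  proof
    fix v assume "v \<in> large_codes m"
    then have "set_decode v \<in> Pow {..<m}"
      by (simp add: large_codes_def)
    then show "v \<in> set_encode ` Pow {..<m}"
      by (metis image_eqI set_decode_inverse)
  qed
qed simp

text \<open>The witness for all covering and comparability questions about the sets
  \<open>codes_containing m i\<close>: a point that avoids precisely the indices in \<open>K\<close>.\<close>

lemma complement_code:
  assumes "K \<subseteq> {..<m}" "2 * card K \<le> m"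
  obtains v where "v \<in> large_codes m"
    "\<And>i. i < m \<Longrightarrow> v \<in> codes_containing m i \<longleftrightarrow> i \<notin> K"
proof
  let ?v = "set_encode ({..<m} - K)"
  have decode: "set_decode ?v = {..<m} - K"
    by (simp add: set_encode_inverse)
  have "card ({..<m} - K) = m - card K"
    using assms(1) by (simp add: card_Diff_subset finite_subset)
  then show v: "?v \<in> large_codes m"
    using assms(2) by (auto simp: large_codes_def decode)
  show "?v \<in> codes_containing m i \<longleftrightarrow> i \<notin> K" if "i < m" for i
    using v that by (simp add: codes_containing_def decode)
qed

lemma codes_containing_subset_iff:
  assumes "2 \<le> m" "i < m" "j < m"
  shows "codes_containing m i \<subseteq> codes_containing m j \<longleftrightarrow> i = j"
proof
  assume sub: "codes_containing m i \<subseteq> codes_containing m j"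
  obtain v where "\<And>l. l < m \<Longrightarrow> v \<in> codes_containing m l \<longleftrightarrow> l \<notin> {j}"
    using complement_code[of "{j}" m] assms by auto
  then show "i = j" using sub assms by blast
qed simp

lemma inj_on_codes_containing:
  assumes "2 \<le> m"
  shows "inj_on (codes_containing m) {..<m}"
  by (rule inj_onI) (metis assms codes_containing_subset_iff lessThan_iff subset_refl)

lemma codes_containing_noncovering:
  assumes "3 \<le> k" "2 * k \<le> m"
  shows "noncovering_family (large_codes m) (codes_containing m ` {..<m}) k"
proof
  fix G assume G: "G \<subseteq> codes_containing m ` {..<m}" and "card G \<le> k"
  obtain K where K: "K \<subseteq> {..<m}" "inj_on (codes_containing m) K" "G = codes_containing m ` K"
    using G by (meson subset_image_inj)
  then have "2 * card K \<le> m"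
    using \<open>card G \<le> k\<close> assms(2) by (simp add: card_image)
  then obtain v where "v \<in> large_codes m"
    "\<And>i. i < m \<Longrightarrow> v \<in> codes_containing m i \<longleftrightarrow> i \<notin> K"
    using complement_code[OF K(1)] by metis
  then show "\<Union>G \<noteq> large_codes m"
    using K by blast
qed (use assms finite_large_codes in \<open>auto simp: codes_containing_def\<close>)

lemma large_code_in_half:
  assumes "2 \<le> m" "v \<in> large_codes m"
  shows "m \<le> 2 * card {C \<in> codes_containing m ` {..<m}. v \<in> C}"
proof -
  have "{C \<in> codes_containing m ` {..<m}. v \<in> C} = codes_containing m ` set_decode v"
    using assms(2) by (auto simp: codes_containing_def large_codes_def)
  moreover have "inj_on (codes_containing m) (set_decode v)"
    using inj_on_codes_containing[OF assms(1)] assms(2)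
    by (auto simp: large_codes_def intro: inj_on_subset)
  ultimately show ?thesis
    using assms(2) by (simp add: card_image large_codes_def)
qed

theorem proposition4:
  fixes m k :: nat
  assumes "3 \<le> k" and "real k \<le> real m / 2"
  shows "\<exists>(V :: nat set) (f :: nat sep \<Rightarrow> nat) (T :: nat osep set).
           finite V \<and> submodular (U_bip V) f \<and> m_tangle V (U_bip V) f m T \<and>
           card (maximal_elements T) = m \<and> resilient V k T \<and>
           \<not> (\<exists>w :: nat \<Rightarrow> real. (\<forall>v \<in> V. 0 \<le> w v) \<and> induces w T)"
proof -
  define V where "V = large_codes m"
  define F where "F = codes_containing m ` {..<m}"
  have m: "2 * k \<le> m" "2 \<le> m"
    using assms by linarith+
  interpret noncovering_family V F k
    unfolding V_def F_def using assms(1) m(1) by (rule codes_containing_noncovering)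
  have card_F: "card F = m"
    unfolding F_def by (simp add: card_image inj_on_codes_containing m(2))
  have "maximal_elements (family_tangle V F) = (\<lambda>C. (C, V - C)) ` F"
    by (rule maximal_elements_family_tangle)
      (auto simp: F_def codes_containing_subset_iff m(2))
  then have "card (maximal_elements (family_tangle V F)) = m"
    by (simp add: card_image inj_on_def card_F)
  moreover have "m_tangle V (U_bip V) (family_order F) m (family_tangle V F)"
    using m_tangle_family_tangle by (simp add: card_F)
  moreover have "\<not> induces w (family_tangle V F)" if "\<forall>v\<in>V. 0 \<le> w v" for w :: "nat \<Rightarrow> real"
  proof (rule family_tangle_not_induced)
    show "F \<noteq> {}" using card_F m(2) by auto
    show "card F \<le> 2 * card {C \<in> F. v \<in> C}" if "v \<in> V" for v
      using large_code_in_half[OF m(2)] that card_F unfolding V_def F_def by simp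
  qed (use that in blast)
  ultimately show ?thesis
    using finite_V submodular_family_order resilient_family_tangle by blast
qed

end
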